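(* Let $n,k\ge 1$ and let $p:\mathbf{C}^n\to\mathbf{C}^k$ be a holomorphic polynomial mapping (not necessarily homogeneous) such that $\|p(z)\|^2<1$ for all $z$ on the unit sphere in $\mathbf{C}^n$. Then there is an integer $N>k$ and a holomorphic polynomial mapping $g:\mathbf{C}^n\to\mathbf{C}^{N-k}$ such that $p\oplus g:\mathbf{C}^n\to\mathbf{C}^N$ defines a proper holomorphic mapping from the unit ball $B_n$ to the unit ball $B_N$.
   Context: $\|\cdot\|$ denotes the complex Euclidean norm, $B_n$ is the open unit ball in $\mathbf{C}^n$, and $(p\oplus g)(z)=(p(z),g(z))$ is the orthogonal direct sum of the mappings. *)

theory Defs
  imports "HOL-Analysis.Analysis"
begin

text \<open>
  The source space \<open>\<complex>\<^sup>n\<close> is \<open>complex^'n\<close>, whose norm is the Euclidean one. The dimension \<open>N\<close> of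
  the target is existentially quantified and so cannot be a type: \<open>\<complex>\<^sup>N\<close> is the set of functions
  \<open>nat \<Rightarrow> complex\<close> vanishing from \<open>N\<close> on. The product topology of the ambient type induces on this
  set the usual topology of \<open>\<complex>\<^sup>N\<close>.
\<close>

definition cspace :: "nat \<Rightarrow> (nat \<Rightarrow> complex) set" where
  "cspace N = {w. \<forall>i\<ge>N. w i = 0}"

definition cnorm :: "nat \<Rightarrow> (nat \<Rightarrow> complex) \<Rightarrow> real" where
  "cnorm N w = L2_set (\<lambda>i. cmod (w i)) {..<N}"

definition unit_ball :: "nat \<Rightarrow> (nat \<Rightarrow> complex) set" where
  "unit_ball N = {w \<in> cspace N. cnorm N w < 1}"

text \<open>A multi-index is a function \<open>\<alpha> :: 'n \<Rightarrow> nat\<close>, and \<open>z\<^sup>\<alpha>\<close> is the product of the \<open>z $ i ^ \<alpha> i\<close>.\<close>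

definition polynomial_fun :: "(complex^'n \<Rightarrow> complex) \<Rightarrow> bool" where
  "polynomial_fun f \<longleftrightarrow>
     (\<exists>(A :: ('n \<Rightarrow> nat) set) c. finite A \<and> (\<forall>z. f z = (\<Sum>\<alpha>\<in>A. c \<alpha> * (\<Prod>i\<in>UNIV. z $ i ^ \<alpha> i))))"

definition polynomial_map :: "nat \<Rightarrow> (complex^'n \<Rightarrow> nat \<Rightarrow> complex) \<Rightarrow> bool" where
  "polynomial_map N f \<longleftrightarrow> (\<forall>z. f z \<in> cspace N) \<and> (\<forall>j<N. polynomial_fun (\<lambda>z. f z j))"

text \<open>Real differentiability with a complex linear derivative.\<close>

definition holomorphic_fun_on :: "(complex^'n \<Rightarrow> complex) \<Rightarrow> (complex^'n) set \<Rightarrow> bool" where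
  "holomorphic_fun_on f U \<longleftrightarrow>
     (\<forall>z\<in>U. \<exists>D. (f has_derivative D) (at z) \<and> (\<forall>a v. D (a *s v) = a * D v))"

definition holomorphic_map_on :: "nat \<Rightarrow> (complex^'n \<Rightarrow> nat \<Rightarrow> complex) \<Rightarrow> (complex^'n) set \<Rightarrow> bool" where
  "holomorphic_map_on N f U \<longleftrightarrow>
     (\<forall>z\<in>U. f z \<in> cspace N) \<and> (\<forall>j<N. holomorphic_fun_on (\<lambda>z. f z j) U)"

definition proper_holomorphic_ball_map :: "nat \<Rightarrow> (complex^'n \<Rightarrow> nat \<Rightarrow> complex) \<Rightarrow> bool" where
  "proper_holomorphic_ball_map N f \<longleftrightarrow>
     holomorphic_map_on N f (ball 0 1) \<and>
     f ` ball 0 1 \<subseteq> unit_ball N \<and>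
     proper_map (top_of_set (ball 0 1)) (top_of_set (unit_ball N)) f"

text \<open>
  The library's notion of properness (closed with compact fibres) agrees here with the usual one,
  that preimages of compact sets are compact.
\<close>

lemma proper_ball_map_iff_compact_preimage:
  fixes f :: "complex^'n \<Rightarrow> nat \<Rightarrow> complex"
  assumes hol: "holomorphic_map_on N f (ball 0 1)" and im: "f ` ball 0 1 \<subseteq> unit_ball N"
  shows "proper_map (top_of_set (ball 0 1)) (top_of_set (unit_ball N)) f \<longleftrightarrow>
           (\<forall>K. K \<subseteq> unit_ball N \<and> compact K \<longrightarrow> compact {z \<in> ball 0 1. f z \<in> K})"
proof -
  let ?X = "top_of_set (ball 0 1 :: (complex^'n) set)" and ?Y = "top_of_set (unit_ball N)"
  have "continuous_on (ball 0 1) (\<lambda>z. f z j)" for j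
  proof (cases "j < N")
    case True
    then show ?thesis
      using hol unfolding holomorphic_map_on_def holomorphic_fun_on_def
      by (meson continuous_at_imp_continuous_on has_derivative_continuous)
  next
    case False
    then have "f z j = 0" if "z \<in> ball 0 1" for z
      using hol that unfolding holomorphic_map_on_def cspace_def by auto
    then show ?thesis
      by (metis (no_types, lifting) continuous_on_cong continuous_on_const)
  qed
  then have "continuous_on (ball 0 1) f"
    by (rule continuous_on_coordinatewise_then_product)
  then have cont: "continuous_map ?X ?Y f"
    using im by (simp add: continuous_map_in_subtopology image_subset_iff_funcset)
  have "metrizable_space ?Y"
    by (simp add: metrizable_space_euclidean metrizable_space_subtopology)
  then have "k_space ?Y" "kc_space ?Y"
    by (simp_all add: metrizable_imp_k_space metrizable_imp_Hausdorff_space Hausdorff_imp_kc_space)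
  then have "proper_map ?X ?Y f \<longleftrightarrow>
      (\<forall>K. compactin ?Y K \<longrightarrow> compactin ?X {z \<in> topspace ?X. f z \<in> K})"
    using cont im by (subst proper_eq_compact_map) auto
  then show ?thesis
    by (auto simp: compactin_subtopology)
qed

text \<open>\<open>k\<close> is the target dimension of \<open>p\<close>; the coordinates of \<open>g\<close> are placed after those of \<open>p\<close>.\<close>

definition direct_sum_map ::
    "nat \<Rightarrow> (complex^'n \<Rightarrow> nat \<Rightarrow> complex) \<Rightarrow> (complex^'n \<Rightarrow> nat \<Rightarrow> complex)
      \<Rightarrow> complex^'n \<Rightarrow> nat \<Rightarrow> complex" where
  "direct_sum_map k p g z = (\<lambda>i. if i < k then p z i else g z (i - k))"

end

theory Submission
  imports Defs "HOL-Complex_Analysis.Conformal_Mappings"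
begin

text \<open>
  Functions that agree on the sphere with \<open>\<parallel>f\<parallel>\<^sup>2\<close> for a holomorphic polynomial mapping \<open>f\<close> form a
  semiring: direct sums add, and tensor products multiply, the squared norms. It contains
  \<open>1 + \<langle>z, b\<rangle>\<close>, which is \<open>\<parallel>z + b\<parallel>\<^sup>2 / 2\<close> on the sphere, for every unit vector \<open>b\<close> and the real inner
  product. A real polynomial that is positive on a cube has nonnegative coefficients in the
  Bernstein basis of large degree, hence is a nonnegative combination of products of such factors.
  So every real polynomial positive on the sphere lies in the semiring; in particular
  \<open>1 - \<parallel>p\<parallel>\<^sup>2 = \<parallel>h\<parallel>\<^sup>2\<close> on the sphere for some \<open>h\<close>, and \<open>g = z \<otimes> h\<close> works by the maximum principle.
\<close>

subsection \<open>Polynomials in a family of functions\<close>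

definition polynomial_in :: "'i set \<Rightarrow> ('i \<Rightarrow> 's \<Rightarrow> 'a::comm_semiring_1) \<Rightarrow> ('s \<Rightarrow> 'a) \<Rightarrow> bool" where
  "polynomial_in I X f \<longleftrightarrow>
     (\<exists>A c. finite A \<and> (\<forall>x. f x = (\<Sum>\<alpha>\<in>A. c \<alpha> * (\<Prod>i\<in>I. X i x ^ \<alpha> i))))"

lemma polynomial_in_sum_monomials:
  fixes X :: "'i \<Rightarrow> 's \<Rightarrow> 'a::comm_semiring_1"
  assumes "finite J"
  shows "polynomial_in I X (\<lambda>x. \<Sum>j\<in>J. c j * (\<Prod>i\<in>I. X i x ^ \<alpha> j i))"
proof -
  have "(\<Sum>j\<in>J. c j * (\<Prod>i\<in>I. X i x ^ \<alpha> j i)) =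
      (\<Sum>\<beta>\<in>\<alpha> ` J. (\<Sum>j | j \<in> J \<and> \<alpha> j = \<beta>. c j) * (\<Prod>i\<in>I. X i x ^ \<beta> i))" for x
    unfolding sum.image_gen[OF assms, of _ \<alpha>] sum_distrib_right
    by (intro sum.cong) auto
  then show ?thesis
    unfolding polynomial_in_def using assms
    by (intro exI[of _ "\<alpha> ` J"] exI[of _ "\<lambda>\<beta>. \<Sum>j | j \<in> J \<and> \<alpha> j = \<beta>. c j"]) simp
qed

lemma polynomial_in_const: "polynomial_in I X (\<lambda>_. c)"
  using polynomial_in_sum_monomials[of "{()}" I X "\<lambda>_. c" "\<lambda>_ _. 0"] by simp

lemma polynomial_in_generator:
  assumes "finite I" "i \<in> I"
  shows "polynomial_in I X (X i)"
proof -
  have "(\<Prod>j\<in>I. X j x ^ (if j = i then 1 else 0)) = X i x" for x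
    using assms by (simp add: if_distrib[of "\<lambda>e. _ ^ e"] cong: if_cong)
  then show ?thesis
    using polynomial_in_sum_monomials[of "{()}" I X "\<lambda>_. 1" "\<lambda>_ j. if j = i then 1 else 0"] by simp
qed

lemma polynomial_in_add:
  assumes "polynomial_in I X f" "polynomial_in I X g"
  shows "polynomial_in I X (\<lambda>x. f x + g x)"
proof -
  obtain A c where A: "finite A" and f: "\<And>x. f x = (\<Sum>\<alpha>\<in>A. c \<alpha> * (\<Prod>i\<in>I. X i x ^ \<alpha> i))"
    using assms(1) unfolding polynomial_in_def by blast
  obtain B d where B: "finite B" and g: "\<And>x. g x = (\<Sum>\<beta>\<in>B. d \<beta> * (\<Prod>i\<in>I. X i x ^ \<beta> i))"
    using assms(2) unfolding polynomial_in_def by blast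
  have "f x + g x = (\<Sum>j\<in>A <+> B. case_sum c d j * (\<Prod>i\<in>I. X i x ^ case_sum id id j i))" for x
    using A B by (simp add: f g sum.Plus)
  then show ?thesis
    using A B by (simp add: polynomial_in_sum_monomials)
qed

lemma polynomial_in_mult:
  assumes "polynomial_in I X f" "polynomial_in I X g"
  shows "polynomial_in I X (\<lambda>x. f x * g x)"
proof -
  obtain A c where A: "finite A" and f: "\<And>x. f x = (\<Sum>\<alpha>\<in>A. c \<alpha> * (\<Prod>i\<in>I. X i x ^ \<alpha> i))"
    using assms(1) unfolding polynomial_in_def by blast
  obtain B d where B: "finite B" and g: "\<And>x. g x = (\<Sum>\<beta>\<in>B. d \<beta> * (\<Prod>i\<in>I. X i x ^ \<beta> i))"
    using assms(2) unfolding polynomial_in_def by blast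
  have "f x * g x = (\<Sum>(\<alpha>, \<beta>)\<in>A \<times> B. (c \<alpha> * d \<beta>) * (\<Prod>i\<in>I. X i x ^ (\<alpha> i + \<beta> i)))" for x
    by (simp add: f g sum_product sum.cartesian_product power_add prod.distrib mult_ac)
  then show ?thesis
    using A B by (simp add: polynomial_in_sum_monomials case_prod_unfold)
qed

lemma polynomial_in_sum:
  assumes "\<And>j. j \<in> J \<Longrightarrow> polynomial_in I X (f j)"
  shows "polynomial_in I X (\<lambda>x. \<Sum>j\<in>J. f j x)"
  using assms
  by (induction J rule: infinite_finite_induct)
    (simp_all add: polynomial_in_const polynomial_in_add)

lemma polynomial_in_induct [consumes 1, case_names const generator add mult]:
  assumes f: "polynomial_in I X f"
    and const: "\<And>c. P (\<lambda>_. c)" and generator: "\<And>i. i \<in> I \<Longrightarrow> P (X i)"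
    and add: "\<And>f g. P f \<Longrightarrow> P g \<Longrightarrow> P (\<lambda>x. f x + g x)"
    and mult: "\<And>f g. P f \<Longrightarrow> P g \<Longrightarrow> P (\<lambda>x. f x * g x)"
  shows "P f"
proof -
  have power: "P (\<lambda>x. X i x ^ m)" if "i \<in> I" for i m
    by (induction m) (simp_all add: const mult[OF generator[OF that]])
  have "P (\<lambda>x. \<Prod>i\<in>J. X i x ^ \<alpha> i)" if "J \<subseteq> I" for J \<alpha>
    using that
    by (induction J rule: infinite_finite_induct) (simp_all add: const mult[OF power])
  then have prod: "P (\<lambda>x. \<Prod>i\<in>I. X i x ^ \<alpha> i)" for \<alpha>
    by simp
  have sum: "P (\<lambda>x. \<Sum>\<alpha>\<in>A. c \<alpha> * (\<Prod>i\<in>I. X i x ^ \<alpha> i))" for A c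
    by (induction A rule: infinite_finite_induct) (simp_all add: const add[OF mult[OF const prod]])
  obtain A c where "f = (\<lambda>x. \<Sum>\<alpha>\<in>A. c \<alpha> * (\<Prod>i\<in>I. X i x ^ \<alpha> i))"
    using f unfolding polynomial_in_def by blast
  then show ?thesis
    using sum by simp
qed

lemma real_polynomial_function_imp_polynomial_in_Basis:
  fixes F :: "'a::euclidean_space \<Rightarrow> real"
  assumes "real_polynomial_function F"
  shows "polynomial_in Basis (\<lambda>b x. x \<bullet> b) F"
  using assms
proof induction
  case (linear f)
  then have "f x = (\<Sum>b\<in>Basis. f b * (x \<bullet> b))" for x
    using Linear_Algebra.linear_componentwise[of f x 1] bounded_linear.linear
    by (auto simp: mult.commute)
  then have "f = (\<lambda>x. \<Sum>b\<in>Basis. f b * (x \<bullet> b))"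
    by blast
  moreover have "polynomial_in Basis (\<lambda>b x. x \<bullet> b) (\<lambda>x. \<Sum>b\<in>Basis. f b * (x \<bullet> b))"
    by (intro polynomial_in_sum polynomial_in_mult polynomial_in_const polynomial_in_generator) auto
  ultimately show ?case
    by simp
qed (simp_all add: polynomial_in_const polynomial_in_add polynomial_in_mult)

subsection \<open>Bernstein expansions on the unit cube\<close>

text \<open>The truncated subtraction makes \<open>falling_ratio N a k\<close> vanish for \<open>k < a\<close>.\<close>

definition falling_ratio :: "nat \<Rightarrow> nat \<Rightarrow> nat \<Rightarrow> real" where
  "falling_ratio N a k = (\<Prod>j<a. real (k - j) / real (N - j))"

lemma falling_ratio_eq_choose:
  assumes "a \<le> N"
  shows "falling_ratio N a k = real (k choose a) / real (N choose a)"
proof (cases "a \<le> k")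
  case True
  have choose: "real (n choose a) = (\<Prod>j<a. real (n - j)) / (\<Prod>j<a. real (a - j))"
    if "a \<le> n" for n
    using binomial_altdef_of_nat[OF that, where 'a=real]
    by (simp add: prod_dividef atLeast0LessThan)
  have "(\<Prod>j<a. real (a - j)) \<noteq> 0"
    by auto
  then show ?thesis
    by (simp add: choose[OF True] choose[OF assms] falling_ratio_def prod_dividef)
next
  case False
  then have "falling_ratio N a k = 0"
    unfolding falling_ratio_def by (intro prod_zero) (auto intro!: bexI[of _ k])
  then show ?thesis
    using False by simp
qed

lemma abs_falling_ratio_le_1:
  assumes "k \<le> N" "a \<le> N"
  shows "\<bar>falling_ratio N a k\<bar> \<le> 1"
  unfolding falling_ratio_def abs_prod
  using assms by (intro prod_le_1) (auto simp: divide_simps)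

lemma falling_ratio_factor_approx:
  assumes "k \<le> N" "j < N"
  shows "\<bar>real (k - j) / real (N - j) - real k / real N\<bar> \<le> real j / real N"
proof (cases "j \<le> k")
  case True
  have pos: "real N > 0" "real N - real j > 0"
    using assms by auto
  define q where "q = (real N - real k) / (real N - real j)"
  have "0 \<le> q" "q \<le> 1"
    using pos True assms by (simp_all add: q_def field_simps)
  then have "0 \<le> real j / real N * q" "real j / real N * q \<le> real j / real N"
    by (auto intro: mult_nonneg_nonneg mult_left_le simp del: times_divide_eq_left)
  moreover have "real k / real N - real (k - j) / real (N - j) = real j / real N * q"
    using pos True assms by (simp add: q_def of_nat_diff field_simps)
  ultimately show ?thesis
    by (simp only: abs_minus_commute[of _ "real k / real N"] abs_of_nonneg)
qed (simp add: divide_right_mono)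

lemma falling_ratio_approx:
  assumes "k \<le> N" "a \<le> N"
  shows "\<bar>falling_ratio N a k - (real k / real N) ^ a\<bar> \<le> (real a)\<^sup>2 / real N"
proof -
  have "\<bar>falling_ratio N a k - (\<Prod>j<a. real k / real N)\<bar> \<le>
      (\<Sum>j<a. norm (real (k - j) / real (N - j) - real k / real N))"
    unfolding falling_ratio_def real_norm_def[symmetric] using assms
    by (intro norm_prod_diff) (auto simp: divide_simps)
  also have "\<dots> \<le> (\<Sum>j<a. real a / real N)"
  proof (rule sum_mono)
    fix j assume "j \<in> {..<a}"
    then have "j < a" "j < N"
      using assms by auto
    then show "norm (real (k - j) / real (N - j) - real k / real N) \<le> real a / real N"
      using falling_ratio_factor_approx[of k N j] assms
        divide_right_mono[of "real j" "real a" "real N"] by simp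
  qed
  finally show ?thesis
    by (simp add: power2_eq_square)
qed

lemma falling_ratio_mult_choose:
  assumes "a \<le> k" "k \<le> N"
  shows "falling_ratio N a k * real (N choose k) = real (N - a choose (k - a))"
proof -
  have "real (N choose k) * real (k choose a) = real (N choose a) * real (N - a choose (k - a))"
    using choose_mult[OF assms] by (metis of_nat_mult)
  then show ?thesis
    using assms by (simp add: falling_ratio_eq_choose field_simps)
qed

lemma sum_falling_ratio_Bernstein:
  assumes "a \<le> N"
  shows "(\<Sum>k\<le>N. falling_ratio N a k * Bernstein N k t) = t ^ a"
proof -
  have "(\<Sum>k\<le>N. falling_ratio N a k * Bernstein N k t) =
      (\<Sum>k=a..N. falling_ratio N a k * Bernstein N k t)"
    using assms by (intro sum.mono_neutral_right) (auto simp: falling_ratio_eq_choose)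
  also have "\<dots> = (\<Sum>k=a..N. t ^ a * (real (N - a choose (k - a)) * t ^ (k - a) * (1 - t) ^ (N - k)))"
  proof (rule sum.cong[OF refl])
    fix k assume "k \<in> {a..N}"
    then have "t ^ k = t ^ a * t ^ (k - a)"
      and "falling_ratio N a k * real (N choose k) = real (N - a choose (k - a))"
      by (simp_all add: falling_ratio_mult_choose flip: power_add)
    then show "falling_ratio N a k * Bernstein N k t =
        t ^ a * (real (N - a choose (k - a)) * t ^ (k - a) * (1 - t) ^ (N - k))"
      by (simp add: Bernstein_def mult_ac)
  qed
  also have "\<dots> = t ^ a * (\<Sum>k\<le>N - a. real (N - a choose k) * t ^ k * (1 - t) ^ (N - a - k))"
    unfolding sum_distrib_left
    by (rule sum.reindex_bij_witness[of _ "\<lambda>k. k + a" "\<lambda>k. k - a"]) (use assms in auto)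
  also have "\<dots> = t ^ a"
    using binomial_ring[of t "1 - t" "N - a"] by simp
  finally show ?thesis .
qed

definition Bernstein_indices :: "nat \<Rightarrow> ('a::euclidean_space \<Rightarrow> nat) set" where
  "Bernstein_indices N = Basis \<rightarrow>\<^sub>E {..N}"

definition Bernstein_prod :: "nat \<Rightarrow> ('a::euclidean_space \<Rightarrow> nat) \<Rightarrow> 'a \<Rightarrow> real" where
  "Bernstein_prod N \<kappa> x = (\<Prod>b\<in>Basis. Bernstein N (\<kappa> b) (x \<bullet> b))"

definition Bernstein_node :: "nat \<Rightarrow> ('a::euclidean_space \<Rightarrow> nat) \<Rightarrow> 'a" where
  "Bernstein_node N \<kappa> = (\<Sum>b\<in>Basis. (real (\<kappa> b) / real N) *\<^sub>R b)"

definition Bernstein_monomial_coeff ::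
    "nat \<Rightarrow> ('a::euclidean_space \<Rightarrow> nat) \<Rightarrow> ('a \<Rightarrow> nat) \<Rightarrow> real" where
  "Bernstein_monomial_coeff N \<alpha> \<kappa> = (\<Prod>b\<in>Basis. falling_ratio N (\<alpha> b) (\<kappa> b))"

lemma Bernstein_indices_le: "\<kappa> \<in> Bernstein_indices N \<Longrightarrow> b \<in> Basis \<Longrightarrow> \<kappa> b \<le> N"
  by (auto simp: Bernstein_indices_def)

lemma inner_Bernstein_node: "b \<in> Basis \<Longrightarrow> Bernstein_node N \<kappa> \<bullet> b = real (\<kappa> b) / real N"
  by (simp add: Bernstein_node_def)

lemma Bernstein_node_in_cbox: "\<kappa> \<in> Bernstein_indices N \<Longrightarrow> Bernstein_node N \<kappa> \<in> cbox 0 One"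
  using Bernstein_indices_le[of \<kappa> N] by (auto simp: mem_box inner_Bernstein_node divide_simps)

lemma monomial_eq_sum_Bernstein_prod:
  fixes x :: "'a::euclidean_space"
  assumes "\<And>b. b \<in> Basis \<Longrightarrow> \<alpha> b \<le> N"
  shows "(\<Prod>b\<in>Basis. (x \<bullet> b) ^ \<alpha> b) =
    (\<Sum>\<kappa>\<in>Bernstein_indices N. Bernstein_monomial_coeff N \<alpha> \<kappa> * Bernstein_prod N \<kappa> x)"
proof -
  have "(\<Prod>b\<in>Basis. (x \<bullet> b) ^ \<alpha> b) =
      (\<Prod>b\<in>Basis. \<Sum>k\<le>N. falling_ratio N (\<alpha> b) k * Bernstein N k (x \<bullet> b))"
    by (simp add: sum_falling_ratio_Bernstein assms)
  also have "\<dots> = (\<Sum>\<kappa>\<in>Bernstein_indices N.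
      \<Prod>b\<in>Basis. falling_ratio N (\<alpha> b) (\<kappa> b) * Bernstein N (\<kappa> b) (x \<bullet> b))"
    unfolding Bernstein_indices_def by (rule prod_sum_PiE) auto
  finally show ?thesis
    by (simp add: Bernstein_monomial_coeff_def Bernstein_prod_def prod.distrib)
qed

lemma Bernstein_monomial_coeff_approx:
  fixes \<alpha> \<kappa> :: "'a::euclidean_space \<Rightarrow> nat"
  assumes \<alpha>: "\<And>b. b \<in> Basis \<Longrightarrow> \<alpha> b \<le> N" and \<kappa>: "\<kappa> \<in> Bernstein_indices N"
  shows "\<bar>Bernstein_monomial_coeff N \<alpha> \<kappa> - (\<Prod>b\<in>Basis. (Bernstein_node N \<kappa> \<bullet> b) ^ \<alpha> b)\<bar>
    \<le> (\<Sum>b\<in>Basis. (real (\<alpha> b))\<^sup>2) / real N"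
proof -
  have "\<bar>Bernstein_monomial_coeff N \<alpha> \<kappa> - (\<Prod>b\<in>Basis. (Bernstein_node N \<kappa> \<bullet> b) ^ \<alpha> b)\<bar> =
      norm (Bernstein_monomial_coeff N \<alpha> \<kappa> - (\<Prod>b\<in>Basis. (real (\<kappa> b) / real N) ^ \<alpha> b))"
    by (simp add: inner_Bernstein_node)
  also have "\<dots> \<le> (\<Sum>b\<in>Basis. norm (falling_ratio N (\<alpha> b) (\<kappa> b) - (real (\<kappa> b) / real N) ^ \<alpha> b))"
    unfolding Bernstein_monomial_coeff_def using abs_falling_ratio_le_1 \<alpha> Bernstein_indices_le[OF \<kappa>]
    by (intro norm_prod_diff) (auto simp: divide_simps power_mono)
  also have "\<dots> \<le> (\<Sum>b\<in>Basis. (real (\<alpha> b))\<^sup>2 / real N)"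
    using falling_ratio_approx \<alpha> Bernstein_indices_le[OF \<kappa>] by (intro sum_mono) simp
  finally show ?thesis
    by (simp add: sum_divide_distrib)
qed

lemma sum_monomials_eq_sum_Bernstein_prod:
  fixes x :: "'a::euclidean_space"
  assumes "\<forall>\<alpha>\<in>A. \<forall>b\<in>Basis. \<alpha> b \<le> N"
  shows "(\<Sum>\<alpha>\<in>A. a \<alpha> * (\<Prod>b\<in>Basis. (x \<bullet> b) ^ \<alpha> b)) =
    (\<Sum>\<kappa>\<in>Bernstein_indices N. (\<Sum>\<alpha>\<in>A. a \<alpha> * Bernstein_monomial_coeff N \<alpha> \<kappa>) * Bernstein_prod N \<kappa> x)"
proof -
  have "(\<Sum>\<alpha>\<in>A. a \<alpha> * (\<Prod>b\<in>Basis. (x \<bullet> b) ^ \<alpha> b)) =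
      (\<Sum>\<alpha>\<in>A. a \<alpha> * (\<Sum>\<kappa>\<in>Bernstein_indices N. Bernstein_monomial_coeff N \<alpha> \<kappa> * Bernstein_prod N \<kappa> x))"
    using assms
    by (intro sum.cong refl arg_cong[where f = "times _"] monomial_eq_sum_Bernstein_prod) auto
  also have "\<dots> = (\<Sum>\<alpha>\<in>A. \<Sum>\<kappa>\<in>Bernstein_indices N.
      a \<alpha> * Bernstein_monomial_coeff N \<alpha> \<kappa> * Bernstein_prod N \<kappa> x)"
    by (simp add: sum_distrib_left mult.assoc)
  also have "\<dots> = (\<Sum>\<kappa>\<in>Bernstein_indices N.
      (\<Sum>\<alpha>\<in>A. a \<alpha> * Bernstein_monomial_coeff N \<alpha> \<kappa>) * Bernstein_prod N \<kappa> x)"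
    unfolding sum_distrib_right by (rule sum.swap)
  finally show ?thesis .
qed

lemma sum_Bernstein_monomial_coeff_approx:
  fixes \<kappa> :: "'a::euclidean_space \<Rightarrow> nat"
  assumes "\<forall>\<alpha>\<in>A. \<forall>b\<in>Basis. \<alpha> b \<le> N" "\<kappa> \<in> Bernstein_indices N"
  shows "\<bar>(\<Sum>\<alpha>\<in>A. a \<alpha> * Bernstein_monomial_coeff N \<alpha> \<kappa>) -
      (\<Sum>\<alpha>\<in>A. a \<alpha> * (\<Prod>b\<in>Basis. (Bernstein_node N \<kappa> \<bullet> b) ^ \<alpha> b))\<bar>
    \<le> (\<Sum>\<alpha>\<in>A. \<bar>a \<alpha>\<bar> * (\<Sum>b\<in>Basis. (real (\<alpha> b))\<^sup>2)) / real N"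
proof -
  let ?error = "\<lambda>\<alpha>. Bernstein_monomial_coeff N \<alpha> \<kappa> - (\<Prod>b\<in>Basis. (Bernstein_node N \<kappa> \<bullet> b) ^ \<alpha> b)"
  have "\<bar>\<Sum>\<alpha>\<in>A. a \<alpha> * ?error \<alpha>\<bar> \<le> (\<Sum>\<alpha>\<in>A. \<bar>a \<alpha>\<bar> * \<bar>?error \<alpha>\<bar>)"
    unfolding abs_mult[symmetric] by (rule sum_abs)
  also have "\<dots> \<le> (\<Sum>\<alpha>\<in>A. \<bar>a \<alpha>\<bar> * ((\<Sum>b\<in>Basis. (real (\<alpha> b))\<^sup>2) / real N))"
    using assms by (intro sum_mono mult_left_mono Bernstein_monomial_coeff_approx) auto
  finally show ?thesis
    by (simp only: sum_divide_distrib[of _ A] times_divide_eq_right right_diff_distrib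
        sum_subtractf)
qed

lemma real_polynomial_function_Bernstein_expansion:
  fixes F :: "'a::euclidean_space \<Rightarrow> real"
  assumes "real_polynomial_function F" "\<epsilon> > 0"
  obtains N c where "\<And>x. F x = (\<Sum>\<kappa>\<in>Bernstein_indices N. c \<kappa> * Bernstein_prod N \<kappa> x)"
    "\<And>\<kappa>. \<kappa> \<in> Bernstein_indices N \<Longrightarrow> \<bar>c \<kappa> - F (Bernstein_node N \<kappa>)\<bar> < \<epsilon>"
proof -
  obtain A a where "finite A" and F: "\<And>x. F x = (\<Sum>\<alpha>\<in>A. a \<alpha> * (\<Prod>b\<in>Basis. (x \<bullet> b) ^ \<alpha> b))"
    using real_polynomial_function_imp_polynomial_in_Basis[OF assms(1)] unfolding polynomial_in_def
    by blast
  define s where "s = (\<Sum>\<alpha>\<in>A. \<bar>a \<alpha>\<bar> * (\<Sum>b\<in>Basis. (real (\<alpha> b))\<^sup>2))"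
  have "\<forall>\<^sub>F N in sequentially. s / real N < \<epsilon>"
    using lim_const_over_n assms(2) by (rule order_tendstoD)
  moreover have "\<forall>\<^sub>F N in sequentially. \<forall>\<alpha>\<in>A. \<forall>b\<in>Basis. \<alpha> b \<le> N"
    using \<open>finite A\<close> by (intro eventually_ball_finite ballI eventually_ge_at_top) auto
  ultimately obtain N where small: "s / real N < \<epsilon>"
    and deg: "\<forall>\<alpha>\<in>A. \<forall>b\<in>Basis. \<alpha> b \<le> N"
    using eventually_happens'[OF sequentially_bot eventually_conj] by blast
  show thesis
  proof (rule that)
    show "F x = (\<Sum>\<kappa>\<in>Bernstein_indices N.
        (\<Sum>\<alpha>\<in>A. a \<alpha> * Bernstein_monomial_coeff N \<alpha> \<kappa>) * Bernstein_prod N \<kappa> x)" for x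
      unfolding F using deg by (rule sum_monomials_eq_sum_Bernstein_prod)
    show "\<bar>(\<Sum>\<alpha>\<in>A. a \<alpha> * Bernstein_monomial_coeff N \<alpha> \<kappa>) - F (Bernstein_node N \<kappa>)\<bar> < \<epsilon>"
      if "\<kappa> \<in> Bernstein_indices N" for \<kappa>
      using sum_Bernstein_monomial_coeff_approx[OF deg that, of a] small by (simp add: F s_def)
  qed
qed

lemma pos_on_cube_imp_nonneg_Bernstein_coeffs:
  fixes F :: "'a::euclidean_space \<Rightarrow> real"
  assumes F: "real_polynomial_function F" and pos: "\<forall>x\<in>cbox 0 One. F x > 0"
  obtains N c where "\<And>x. F x = (\<Sum>\<kappa>\<in>Bernstein_indices N. c \<kappa> * Bernstein_prod N \<kappa> x)"
    "\<And>\<kappa>. \<kappa> \<in> Bernstein_indices N \<Longrightarrow> c \<kappa> \<ge> 0"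
proof -
  have "continuous_on (cbox 0 One) F"
    using F by (simp add: continuous_on_polymonial_function real_polynomial_function_eq)
  moreover have "cbox 0 One \<noteq> ({} :: 'a set)"
    by (simp add: box_ne_empty)
  ultimately obtain y where y: "y \<in> cbox 0 One" "\<And>x. x \<in> cbox 0 One \<Longrightarrow> F y \<le> F x"
    using continuous_attains_inf[of "cbox 0 One" F] by auto
  obtain N c where expansion: "\<And>x. F x = (\<Sum>\<kappa>\<in>Bernstein_indices N. c \<kappa> * Bernstein_prod N \<kappa> x)"
    and approx: "\<And>\<kappa>. \<kappa> \<in> Bernstein_indices N \<Longrightarrow> \<bar>c \<kappa> - F (Bernstein_node N \<kappa>)\<bar> < F y"
    by (rule real_polynomial_function_Bernstein_expansion[OF F bspec[OF pos y(1)]]) (rule that)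
  have "c \<kappa> \<ge> 0" if "\<kappa> \<in> Bernstein_indices N" for \<kappa>
    using approx[OF that] y(2)[OF Bernstein_node_in_cbox[OF that]] by linarith
  with expansion show thesis
    by (rule that)
qed

subsection \<open>Holomorphic polynomials\<close>

lemma polynomial_fun_iff: "polynomial_fun f \<longleftrightarrow> polynomial_in UNIV (\<lambda>i z. z $ i) f"
  by (simp add: polynomial_fun_def polynomial_in_def)

lemma polynomial_fun_const: "polynomial_fun (\<lambda>_. c)"
  by (simp add: polynomial_fun_iff polynomial_in_const)

lemma polynomial_fun_nth: "polynomial_fun (\<lambda>z. z $ i)"
  unfolding polynomial_fun_iff by (rule polynomial_in_generator) auto

lemma polynomial_fun_add:
  "polynomial_fun f \<Longrightarrow> polynomial_fun g \<Longrightarrow> polynomial_fun (\<lambda>z. f z + g z)"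
  unfolding polynomial_fun_iff by (rule polynomial_in_add)

lemma polynomial_fun_mult:
  "polynomial_fun f \<Longrightarrow> polynomial_fun g \<Longrightarrow> polynomial_fun (\<lambda>z. f z * g z)"
  unfolding polynomial_fun_iff by (rule polynomial_in_mult)

lemma polynomial_fun_sum:
  "(\<And>j. j \<in> J \<Longrightarrow> polynomial_fun (f j)) \<Longrightarrow> polynomial_fun (\<lambda>z. \<Sum>j\<in>J. f j z)"
  unfolding polynomial_fun_iff by (rule polynomial_in_sum)

lemma polynomial_fun_induct [consumes 1, case_names const nth add mult]:
  assumes "polynomial_fun f"
    and "\<And>c. P (\<lambda>_. c)" and "\<And>i. P (\<lambda>z. z $ i)"
    and "\<And>f g. P f \<Longrightarrow> P g \<Longrightarrow> P (\<lambda>z. f z + g z)"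
    and "\<And>f g. P f \<Longrightarrow> P g \<Longrightarrow> P (\<lambda>z. f z * g z)"
  shows "P f"
  using assms(1) unfolding polynomial_fun_iff
  by (induction rule: polynomial_in_induct) (simp_all add: assms(2-))

lemma polynomial_fun_imp_holomorphic_fun_on:
  assumes "polynomial_fun f"
  shows "holomorphic_fun_on f U"
proof -
  have "\<exists>D. (f has_derivative D) (at z) \<and> (\<forall>a v. D (a *s v) = a * D v)" for z
    using assms
  proof (induction rule: polynomial_fun_induct)
    case (const c)
    show ?case
      by (intro exI[of _ "\<lambda>_. 0"]) simp
  next
    case (nth i)
    show ?case
      by (intro exI[of _ "\<lambda>v. v $ i"])
        (simp add: bounded_linear_imp_has_derivative bounded_linear_vec_nth)
  next
    case (add f g)
    then obtain D E where "(f has_derivative D) (at z)" "\<forall>a v. D (a *s v) = a * D v"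
      "(g has_derivative E) (at z)" "\<forall>a v. E (a *s v) = a * E v"
      by blast
    then show ?case
      by (intro exI[of _ "\<lambda>v. D v + E v"]) (simp add: has_derivative_add distrib_left)
  next
    case (mult f g)
    then obtain D E where "(f has_derivative D) (at z)" "\<forall>a v. D (a *s v) = a * D v"
      "(g has_derivative E) (at z)" "\<forall>a v. E (a *s v) = a * E v"
      by blast
    then show ?case
      by (intro exI[of _ "\<lambda>v. f z * E v + D v * g z"] conjI has_derivative_mult)
        (simp_all add: algebra_simps)
  qed
  then show ?thesis
    by (simp add: holomorphic_fun_on_def)
qed

lemma continuous_on_polynomial_fun: "polynomial_fun f \<Longrightarrow> continuous_on S f"
  by (induction rule: polynomial_fun_induct)
    (simp_all add: continuous_on_add continuous_on_mult continuous_on_component)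

lemma holomorphic_on_polynomial_fun_line:
  "polynomial_fun f \<Longrightarrow> (\<lambda>\<zeta>. f (\<zeta> *s v)) holomorphic_on S"
  by (induction rule: polynomial_fun_induct) (auto intro!: holomorphic_intros)

lemma real_polynomial_function_Re_Im_polynomial_fun:
  assumes "polynomial_fun f"
  shows "real_polynomial_function (\<lambda>z. Re (f z))" "real_polynomial_function (\<lambda>z. Im (f z))"
proof -
  have "real_polynomial_function (\<lambda>z. Re (f z)) \<and> real_polynomial_function (\<lambda>z. Im (f z))"
    using assms
  proof (induction rule: polynomial_fun_induct)
    case (nth i)
    then show ?case
      by (simp add: real_polynomial_function.intros(1) bounded_linear_compose[OF bounded_linear_Re]
          bounded_linear_compose[OF bounded_linear_Im] bounded_linear_vec_nth)
  qed auto
  then show "real_polynomial_function (\<lambda>z. Re (f z))" "real_polynomial_function (\<lambda>z. Im (f z))"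
    by simp_all
qed

lemma norm_vector_smult: "norm (a *s z) = cmod a * norm z" for z :: "complex^'n"
  by (simp add: norm_vec_def norm_mult L2_set_right_distrib)

lemma polynomial_fun_maximum_modulus:
  fixes f :: "complex^'n \<Rightarrow> complex"
  assumes f: "polynomial_fun f" and z: "norm z \<le> 1"
  obtains w where "norm w = 1" "cmod (f z) \<le> cmod (f w)"
proof -
  obtain e :: "complex^'n" where e: "norm e = 1" "z = of_real (norm z) *s e"
  proof (cases "z = 0")
    case True
    then show ?thesis
      using that vector_choose_size[of 1] by (auto simp: vec_eq_iff)
  next
    case False
    have "of_real (norm z) *s sgn z = norm z *\<^sub>R sgn z"
      by (simp add: vec_eq_iff scaleR_conv_of_real[where 'a = complex])
    also have "\<dots> = z"
      using False by (simp add: sgn_div_norm)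
    finally show ?thesis
      using that[of "sgn z"] False by (simp add: norm_sgn)
  qed
  have "continuous_on (sphere 0 1) (\<lambda>w. cmod (f w))"
    by (intro continuous_intros continuous_on_polynomial_fun f)
  moreover have "sphere 0 1 \<noteq> ({} :: (complex^'n) set)"
    using e(1) by auto
  ultimately obtain w where w: "norm w = 1" "\<And>v. norm v = 1 \<Longrightarrow> cmod (f v) \<le> cmod (f w)"
    using continuous_attains_sup[of "sphere 0 1" "\<lambda>w. cmod (f w)"] by auto
  have "cmod (f (of_real (norm z) *s e)) \<le> cmod (f w)"
    by (rule maximum_modulus_frontier[where f = "\<lambda>\<zeta>. f (\<zeta> *s e)" and S = "cball 0 1"])
      (use z e(1) w in \<open>auto simp: norm_vector_smult holomorphic_on_polynomial_fun_line f
        intro: holomorphic_on_imp_continuous_on\<close>)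
  with w(1) show ?thesis
    using that e(2) by metis
qed

subsection \<open>Polynomial mappings\<close>

lemma polynomial_map_imp_polynomial_fun: "polynomial_map N f \<Longrightarrow> j < N \<Longrightarrow> polynomial_fun (\<lambda>z. f z j)"
  by (simp add: polynomial_map_def)

lemma cnorm_nonneg [simp]: "0 \<le> cnorm N w"
  by (simp add: cnorm_def)

lemma cnorm_power2: "(cnorm N w)\<^sup>2 = (\<Sum>i<N. (cmod (w i))\<^sup>2)"
  by (simp add: cnorm_def L2_set_def sum_nonneg)

lemma norm_sum_mult_le_cnorm_mult: "cmod (\<Sum>i<N. v i * w i) \<le> cnorm N v * cnorm N w"
proof -
  have "cmod (\<Sum>i<N. v i * w i) \<le> (\<Sum>i<N. cmod (v i) * cmod (w i))"
    by (rule sum_norm_le) (simp add: norm_mult)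
  also have "\<dots> \<le> cnorm N v * cnorm N w"
    using L2_set_mult_ineq[of "\<lambda>i. cmod (v i)" "\<lambda>i. cmod (w i)" "{..<N}"] by (simp add: cnorm_def)
  finally show ?thesis .
qed

text \<open>Pairing \<open>f\<close> with the fixed vector \<open>f z\<close> reduces this to the scalar maximum principle.\<close>

lemma polynomial_map_maximum_norm:
  fixes f :: "complex^'n \<Rightarrow> nat \<Rightarrow> complex"
  assumes f: "polynomial_map N f" and z: "norm z \<le> 1"
  obtains w where "norm w = 1" "cnorm N (f z) \<le> cnorm N (f w)"
proof -
  define \<phi> where "\<phi> w = (\<Sum>j<N. cnj (f z j) * f w j)" for w
  have "polynomial_fun \<phi>"
    unfolding \<phi>_def using polynomial_map_imp_polynomial_fun[OF f]
    by (intro polynomial_fun_sum polynomial_fun_mult polynomial_fun_const) simp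
  then obtain w where w: "norm w = 1" "cmod (\<phi> z) \<le> cmod (\<phi> w)"
    using polynomial_fun_maximum_modulus z by blast
  have "\<phi> z = of_real ((cnorm N (f z))\<^sup>2)"
    unfolding \<phi>_def cnorm_power2 by (simp add: mult.commute flip: complex_norm_square)
  then have "(cnorm N (f z))\<^sup>2 = cmod (\<phi> z)"
    by (simp add: norm_power)
  also have "\<dots> \<le> cnorm N (\<lambda>j. cnj (f z j)) * cnorm N (f w)"
    using w(2) norm_sum_mult_le_cnorm_mult[of "\<lambda>j. cnj (f z j)" "f w" N] by (simp add: \<phi>_def)
  finally have "cnorm N (f z) * cnorm N (f z) \<le> cnorm N (f z) * cnorm N (f w)"
    by (simp add: power2_eq_square cnorm_def)
  then have "cnorm N (f z) \<le> cnorm N (f w)"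
    by (cases "cnorm N (f z) = 0") (auto simp: less_le)
  with w(1) show ?thesis
    by (rule that)
qed

lemma continuous_on_polynomial_map:
  assumes "polynomial_map N f"
  shows "continuous_on S f"
proof (rule continuous_on_coordinatewise_then_product)
  show "continuous_on S (\<lambda>z. f z j)" for j
  proof (cases "j < N")
    case True
    then show ?thesis
      by (intro continuous_on_polynomial_fun polynomial_map_imp_polynomial_fun[OF assms])
  next
    case False
    then have "(\<lambda>z. f z j) = (\<lambda>_. 0)"
      using assms by (auto simp: polynomial_map_def cspace_def)
    then show ?thesis
      by (metis continuous_on_const)
  qed
qed

lemma real_polynomial_function_cnorm_power2:
  assumes "polynomial_map N f"
  shows "real_polynomial_function (\<lambda>z. (cnorm N (f z))\<^sup>2)"
  unfolding cnorm_power2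
proof (rule real_polynomial_function_sum)
  fix i assume "i \<in> {..<N}"
  then have "polynomial_fun (\<lambda>z. f z i)"
    using polynomial_map_imp_polynomial_fun[OF assms] by simp
  then show "real_polynomial_function (\<lambda>z. (cmod (f z i))\<^sup>2)"
    unfolding cmod_power2
    using real_polynomial_function_Re_Im_polynomial_fun
    by (intro real_polynomial_function.intros(3) real_polynomial_function_power)
qed simp

lemma proper_holomorphic_ball_map_polynomial_map:
  fixes f :: "complex^'n \<Rightarrow> nat \<Rightarrow> complex"
  assumes f: "polynomial_map N f"
    and inside: "\<And>z. norm z < 1 \<Longrightarrow> cnorm N (f z) < 1"
    and boundary: "\<And>z. norm z = 1 \<Longrightarrow> cnorm N (f z) = 1"
  shows "proper_holomorphic_ball_map N f"
proof -
  have cspace: "f z \<in> cspace N" for z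
    using f by (simp add: polynomial_map_def)
  have hol: "holomorphic_map_on N f (ball 0 1)"
    using cspace polynomial_map_imp_polynomial_fun[OF f]
    by (simp add: holomorphic_map_on_def polynomial_fun_imp_holomorphic_fun_on)
  have im: "f ` ball 0 1 \<subseteq> unit_ball N"
    using cspace inside by (auto simp: unit_ball_def)
  have "compact {z \<in> ball 0 1. f z \<in> K}" if "K \<subseteq> unit_ball N" "compact K" for K
  proof -
    have "norm z \<noteq> 1" if "f z \<in> K" for z
      using that \<open>K \<subseteq> unit_ball N\<close> boundary[of z] by (auto simp: unit_ball_def)
    then have "{z \<in> ball 0 1. f z \<in> K} = cball 0 1 \<inter> f -` K"
      by (auto simp: less_le)
    moreover have "closed (f -` K)"
      using compact_imp_closed[OF \<open>compact K\<close>] continuous_on_polynomial_map[OF f]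
      by (rule closed_vimage)
    ultimately show ?thesis
      by (simp add: compact_Int_closed)
  qed
  then show ?thesis
    using hol im by (simp add: proper_holomorphic_ball_map_def proper_ball_map_iff_compact_preimage)
qed

lemma polynomial_map_direct_sum_map:
  assumes "polynomial_map k p" "polynomial_map m g"
  shows "polynomial_map (k + m) (direct_sum_map k p g)"
  unfolding polynomial_map_def
proof (intro conjI allI impI)
  show "direct_sum_map k p g z \<in> cspace (k + m)" for z
    using assms(2) by (auto simp: polynomial_map_def direct_sum_map_def cspace_def)
  show "polynomial_fun (\<lambda>z. direct_sum_map k p g z j)" if "j < k + m" for j
    using that assms by (cases "j < k") (simp_all add: direct_sum_map_def polynomial_map_def)
qed

lemma cnorm_direct_sum_map_power2:
  "(cnorm (k + m) (direct_sum_map k p g z))\<^sup>2 = (cnorm k (p z))\<^sup>2 + (cnorm m (g z))\<^sup>2"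
  unfolding cnorm_power2 by (induction m) (simp_all add: direct_sum_map_def)

definition tensor_map ::
    "nat \<Rightarrow> (complex^'n \<Rightarrow> nat \<Rightarrow> complex) \<Rightarrow> (complex^'n \<Rightarrow> nat \<Rightarrow> complex)
      \<Rightarrow> complex^'n \<Rightarrow> nat \<Rightarrow> complex" where
  "tensor_map m f g z = (\<lambda>i. f z (i div m) * g z (i mod m))"

lemma polynomial_map_tensor_map:
  assumes "polynomial_map k f" "polynomial_map m g"
  shows "polynomial_map (k * m) (tensor_map m f g)"
  unfolding polynomial_map_def
proof (intro conjI allI impI)
  have "tensor_map m f g z i = 0" if "i \<ge> k * m" for z i
  proof (cases "m = 0")
    case True
    then show ?thesis
      using assms(2) by (simp add: tensor_map_def polynomial_map_def cspace_def)
  next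
    case False
    then have "i div m \<ge> k"
      using that by (simp add: less_eq_div_iff_mult_less_eq)
    then show ?thesis
      using assms(1) by (simp add: tensor_map_def polynomial_map_def cspace_def)
  qed
  then show "tensor_map m f g z \<in> cspace (k * m)" for z
    by (simp add: cspace_def)
  show "polynomial_fun (\<lambda>z. tensor_map m f g z i)" if "i < k * m" for i
  proof -
    have "i div m < k"
      using that by (rule less_mult_imp_div_less)
    moreover have "i mod m < m"
      using that by (cases "m = 0") auto
    ultimately show ?thesis
      unfolding tensor_map_def using assms
      by (intro polynomial_fun_mult polynomial_map_imp_polynomial_fun)
  qed
qed

lemma cnorm_tensor_map_power2:
  "(cnorm (k * m) (tensor_map m f g z))\<^sup>2 = (cnorm k (f z))\<^sup>2 * (cnorm m (g z))\<^sup>2"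
proof -
  have "(\<Sum>i<k * m. (cmod (tensor_map m f g z i))\<^sup>2) =
      (\<Sum>i<k. \<Sum>j = i * m..<i * m + m. (cmod (tensor_map m f g z j))\<^sup>2)"
    by (rule sum.nat_group[symmetric])
  also have "\<dots> = (\<Sum>i<k. \<Sum>j<m. (cmod (f z i))\<^sup>2 * (cmod (g z j))\<^sup>2)"
  proof (rule sum.cong[OF refl])
    fix i
    have "(\<Sum>j = i * m..<i * m + m. (cmod (tensor_map m f g z j))\<^sup>2) =
        (\<Sum>j<m. (cmod (tensor_map m f g z (j + i * m)))\<^sup>2)"
      using sum.shift_bounds_nat_ivl[of _ 0 "i * m" m] by (simp add: add.commute atLeast0LessThan)
    also have "\<dots> = (\<Sum>j<m. (cmod (f z i))\<^sup>2 * (cmod (g z j))\<^sup>2)"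
      by (intro sum.cong refl) (simp add: tensor_map_def norm_mult power_mult_distrib)
    finally show "(\<Sum>j = i * m..<i * m + m. (cmod (tensor_map m f g z j))\<^sup>2) =
        (\<Sum>j<m. (cmod (f z i))\<^sup>2 * (cmod (g z j))\<^sup>2)" .
  qed
  finally show ?thesis
    by (simp add: cnorm_power2 sum_product)
qed

subsection \<open>The semiring of squared norms\<close>

definition squared_norm_on :: "(complex^'n) set \<Rightarrow> (complex^'n \<Rightarrow> real) \<Rightarrow> bool" where
  "squared_norm_on S u \<longleftrightarrow> (\<exists>N f. polynomial_map N f \<and> (\<forall>z\<in>S. u z = (cnorm N (f z))\<^sup>2))"

lemma squared_norm_on_cnorm_power2:
  "polynomial_map N f \<Longrightarrow> squared_norm_on S (\<lambda>z. (cnorm N (f z))\<^sup>2)"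
  unfolding squared_norm_on_def by blast

lemma squared_norm_on_cong:
  assumes "squared_norm_on S u" "\<And>z. z \<in> S \<Longrightarrow> v z = u z"
  shows "squared_norm_on S v"
  using assms unfolding squared_norm_on_def by simp

lemma squared_norm_on_cmod_power2:
  assumes "polynomial_fun h"
  shows "squared_norm_on S (\<lambda>z. (cmod (h z))\<^sup>2)"
proof -
  have "polynomial_map 1 (\<lambda>z i. if i = 0 then h z else 0)"
    using assms by (simp add: polynomial_map_def cspace_def)
  then show ?thesis
    using squared_norm_on_cnorm_power2 by (fastforce simp: cnorm_power2)
qed

lemma squared_norm_on_const:
  assumes "c \<ge> 0"
  shows "squared_norm_on S (\<lambda>_. c)"
  using squared_norm_on_cmod_power2[OF polynomial_fun_const[of "of_real (sqrt c)"]] assms by simp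

lemma squared_norm_on_add:
  assumes "squared_norm_on S u" "squared_norm_on S v"
  shows "squared_norm_on S (\<lambda>z. u z + v z)"
  using assms unfolding squared_norm_on_def
  by (metis (no_types, lifting) polynomial_map_direct_sum_map cnorm_direct_sum_map_power2)

lemma squared_norm_on_mult:
  assumes "squared_norm_on S u" "squared_norm_on S v"
  shows "squared_norm_on S (\<lambda>z. u z * v z)"
  using assms unfolding squared_norm_on_def
  by (metis (no_types, lifting) polynomial_map_tensor_map cnorm_tensor_map_power2)

lemma squared_norm_on_sum:
  "(\<And>j. j \<in> J \<Longrightarrow> squared_norm_on S (u j)) \<Longrightarrow> squared_norm_on S (\<lambda>z. \<Sum>j\<in>J. u j z)"
  by (induction J rule: infinite_finite_induct)
    (simp_all add: squared_norm_on_const squared_norm_on_add)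

lemma squared_norm_on_prod:
  "(\<And>j. j \<in> J \<Longrightarrow> squared_norm_on S (u j)) \<Longrightarrow> squared_norm_on S (\<lambda>z. \<Prod>j\<in>J. u j z)"
  by (induction J rule: infinite_finite_induct)
    (simp_all add: squared_norm_on_const squared_norm_on_mult)

lemma squared_norm_on_power: "squared_norm_on S u \<Longrightarrow> squared_norm_on S (\<lambda>z. u z ^ m)"
  by (induction m) (simp_all add: squared_norm_on_const squared_norm_on_mult)

lemma squared_norm_on_norm_add_power2: "squared_norm_on S (\<lambda>z. (norm (z + a))\<^sup>2)"
proof -
  have "squared_norm_on S (\<lambda>z. \<Sum>i\<in>UNIV. (cmod (z $ i + a $ i))\<^sup>2)"
    by (intro squared_norm_on_sum squared_norm_on_cmod_power2 polynomial_fun_add polynomial_fun_nth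
        polynomial_fun_const)
  then show ?thesis
    by (simp add: norm_vec_def L2_set_def sum_nonneg)
qed

lemma squared_norm_on_sphere_one_plus_inner:
  assumes "norm b = 1"
  shows "squared_norm_on (sphere 0 1) (\<lambda>z. (1 + z \<bullet> b) / 2)"
proof (rule squared_norm_on_cong)
  show "squared_norm_on (sphere 0 1) (\<lambda>z. 1 / 4 * (norm (z + b))\<^sup>2)"
    by (intro squared_norm_on_mult squared_norm_on_const squared_norm_on_norm_add_power2) simp
  show "(1 + z \<bullet> b) / 2 = 1 / 4 * (norm (z + b))\<^sup>2" if "z \<in> sphere 0 1" for z
    using that assms by (simp add: dot_norm field_simps)
qed

subsection \<open>Polynomials positive on the sphere\<close>

lemma compact_sublevel_set:
  fixes f :: "'a::topological_space \<Rightarrow> real"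
  assumes "compact K" "continuous_on K f"
  shows "compact {x \<in> K. f x \<le> a}"
proof -
  have "closedin (top_of_set K) (K \<inter> f -` {..a})"
    using assms(2) closed_atMost by (rule continuous_closedin_preimage)
  moreover have "K \<inter> f -` {..a} = {x \<in> K. f x \<le> a}"
    by auto
  ultimately show ?thesis
    using closedin_compact[OF assms(1)] by simp
qed

lemma compact_pos_add_mult_nonneg:
  fixes r q :: "'a::heine_borel \<Rightarrow> real"
  assumes K: "compact K" and r: "continuous_on K r" and q: "continuous_on K q"
    and nonneg: "\<And>x. x \<in> K \<Longrightarrow> q x \<ge> 0"
    and pos: "\<And>x. x \<in> K \<Longrightarrow> q x = 0 \<Longrightarrow> r x > 0"
  obtains C where "\<And>x. x \<in> K \<Longrightarrow> r x + C * q x > 0"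
proof -
  define L where "L n = {x \<in> K. r x + real n * q x \<le> 0}" for n
  have "\<exists>n. L n = {}"
  proof (rule ccontr)
    assume "\<nexists>n. L n = {}"
    moreover have "compact (L n)" for n
      unfolding L_def by (intro compact_sublevel_set K continuous_intros r q)
    moreover have "L n \<subseteq> L m" if "m \<le> n" for m n
    proof
      fix x assume "x \<in> L n"
      moreover from this have "real m * q x \<le> real n * q x"
        using that nonneg by (simp add: L_def mult_right_mono)
      ultimately show "x \<in> L m"
        by (simp add: L_def)
    qed
    ultimately have "\<Inter> (range L) \<noteq> {}"
      by (intro compact_nest) auto
    then obtain x where x: "x \<in> L n" for n
      by blast
    have "x \<in> K" "r x \<le> 0"
      using x[of 0] by (simp_all add: L_def)
    then have "q x > 0"
      using nonneg pos by force
    then obtain n where "- r x < real n * q x"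
      using reals_Archimedean3 by blast
    then show False
      using x[of n] by (simp add: L_def)
  qed
  then obtain n where "L n = {}" ..
  then show thesis
    by (intro that[of "real n"]) (auto simp: L_def not_le)
qed

lemma pos_on_sphere_imp_pos_on_compact:
  fixes F :: "'a::euclidean_space \<Rightarrow> real"
  assumes "compact K" "continuous_on K F" "\<And>x. norm x = 1 \<Longrightarrow> F x > 0"
  obtains C where "\<And>x. x \<in> K \<Longrightarrow> F x + C * ((norm x)\<^sup>2 - 1)\<^sup>2 > 0"
proof (rule compact_pos_add_mult_nonneg[OF assms(1,2)])
  show "continuous_on K (\<lambda>x. ((norm x)\<^sup>2 - 1)\<^sup>2)"
    by (intro continuous_intros)
  show "F x > 0" if "((norm x)\<^sup>2 - 1)\<^sup>2 = 0" for x
    using that assms(3)[of x] by (simp add: power2_eq_1_iff) (smt (verit) norm_ge_zero)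
qed (use that in auto)

lemma real_polynomial_function_norm_power2:
  "real_polynomial_function (\<lambda>x :: 'a::euclidean_space. (norm x)\<^sup>2)"
proof -
  have "real_polynomial_function (\<lambda>x :: 'a. \<Sum>b\<in>Basis. (x \<bullet> b)\<^sup>2)"
    by (intro real_polynomial_function_sum real_polynomial_function_power
        real_polynomial_function.intros(1) bounded_linear_inner_left) simp
  then show ?thesis
    unfolding power2_norm_eq_inner by (subst euclidean_inner) (simp add: power2_eq_square)
qed

lemma squared_norm_on_sphere_Bernstein_prod:
  fixes \<kappa> :: "complex^'n \<Rightarrow> nat"
  shows "squared_norm_on (sphere 0 1) (\<lambda>z. Bernstein_prod N \<kappa> ((1 / 2) *\<^sub>R (One + z)))"
proof -
  define t where "t z = (1 / 2) *\<^sub>R (One + z)" for z :: "complex^'n"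
  have inner_t: "t z \<bullet> b = (1 + z \<bullet> b) / 2" "1 - t z \<bullet> b = (1 + z \<bullet> (- b)) / 2"
    if "b \<in> Basis" for z b
    using that by (simp_all add: t_def inner_add_left field_simps)
  have "squared_norm_on (sphere 0 1) (\<lambda>z. t z \<bullet> b)" if "b \<in> Basis" for b
    unfolding inner_t(1)[OF that] using that by (intro squared_norm_on_sphere_one_plus_inner) simp
  moreover have "squared_norm_on (sphere 0 1) (\<lambda>z. 1 - t z \<bullet> b)" if "b \<in> Basis" for b
    unfolding inner_t(2)[OF that] using that by (intro squared_norm_on_sphere_one_plus_inner) simp
  ultimately show ?thesis
    unfolding Bernstein_prod_def Bernstein_def t_def[symmetric]
    by (intro squared_norm_on_prod squared_norm_on_mult squared_norm_on_power
        squared_norm_on_const) auto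
qed

text \<open>
  This is the theorem of Quillen and of Catlin and D'Angelo. Adding a multiple of \<open>(\<parallel>z\<parallel>\<^sup>2 - 1)\<^sup>2\<close>
  does not change the values on the sphere and achieves positivity on the cube around it.
\<close>

theorem pos_on_sphere_imp_squared_norm_on:
  fixes F :: "complex^'n \<Rightarrow> real"
  assumes F: "real_polynomial_function F" and pos: "\<And>z. norm z = 1 \<Longrightarrow> F z > 0"
  shows "squared_norm_on (sphere 0 1) F"
proof -
  have cont: "continuous_on (cbox (- One) One) F"
    using F by (simp add: continuous_on_polymonial_function real_polynomial_function_eq)
  obtain C where C: "\<And>z. z \<in> cbox (- One) One \<Longrightarrow> F z + C * ((norm z)\<^sup>2 - 1)\<^sup>2 > 0"
    using pos_on_sphere_imp_pos_on_compact[OF compact_cbox cont pos] by blast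
  define H where "H z = F z + C * ((norm z)\<^sup>2 - 1)\<^sup>2" for z
  define G where "G = H \<circ> (\<lambda>x. 2 *\<^sub>R x - One)"
  have "real_polynomial_function H"
    unfolding H_def
    by (intro real_polynomial_function.intros(2-4) real_polynomial_function_diff
        real_polynomial_function_power real_polynomial_function_norm_power2 F)
  then have "real_polynomial_function G"
    unfolding G_def by (intro real_polynomial_function_compose) auto
  moreover have "\<forall>x\<in>cbox 0 One. G x > 0"
    unfolding G_def H_def o_def by (intro ballI C) (auto simp: mem_box algebra_simps)
  ultimately obtain N c where G: "\<And>x. G x = (\<Sum>\<kappa>\<in>Bernstein_indices N. c \<kappa> * Bernstein_prod N \<kappa> x)"
    and c: "\<And>\<kappa>. \<kappa> \<in> Bernstein_indices N \<Longrightarrow> c \<kappa> \<ge> 0"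
    by (rule pos_on_cube_imp_nonneg_Bernstein_coeffs) (rule that)
  have "squared_norm_on (sphere 0 1) (\<lambda>z. G ((1 / 2) *\<^sub>R (One + z)))"
    unfolding G using c
    by (intro squared_norm_on_sum squared_norm_on_mult squared_norm_on_const
        squared_norm_on_sphere_Bernstein_prod)
  then show ?thesis
    by (rule squared_norm_on_cong) (simp add: G_def H_def)
qed

subsection \<open>Completion to a proper mapping\<close>

text \<open>
  The factor \<open>\<parallel>z\<parallel>\<^sup>2\<close> gives strictness: \<open>\<parallel>p\<parallel>\<^sup>2 + \<parallel>h\<parallel>\<^sup>2\<close> alone is identically 1 on the ball when
  \<open>p\<close> and \<open>h\<close> are constant.
\<close>

lemma direct_sum_tensor_norm_less_1:
  assumes p: "polynomial_map k p" and h: "polynomial_map m h"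
    and sphere: "\<And>w. norm w = 1 \<Longrightarrow> (cnorm k (p w))\<^sup>2 + (cnorm m (h w))\<^sup>2 = 1"
    and p_less_1: "\<And>w. norm w = 1 \<Longrightarrow> cnorm k (p w) < 1"
    and z: "norm z < 1"
  shows "(cnorm k (p z))\<^sup>2 + (norm z)\<^sup>2 * (cnorm m (h z))\<^sup>2 < 1"
proof (cases "cnorm m (h z) = 0")
  case True
  obtain w where "norm w = 1" "cnorm k (p z) \<le> cnorm k (p w)"
    using polynomial_map_maximum_norm[OF p] z by (metis less_imp_le)
  then have "cnorm k (p z) < 1"
    using p_less_1 by force
  then show ?thesis
    using True by (simp add: abs_square_less_1)
next
  case False
  let ?f = "direct_sum_map k p h"
  obtain w where "norm w = 1" "cnorm (k + m) (?f z) \<le> cnorm (k + m) (?f w)"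
    using polynomial_map_maximum_norm[OF polynomial_map_direct_sum_map[OF p h]] z
    by (metis less_imp_le)
  then have "(cnorm (k + m) (?f z))\<^sup>2 \<le> 1"
    using sphere power_mono[OF _ cnorm_nonneg] by (metis cnorm_direct_sum_map_power2)
  moreover have "(norm z)\<^sup>2 * (cnorm m (h z))\<^sup>2 < (cnorm m (h z))\<^sup>2"
    using False z by (simp add: abs_square_less_1)
  ultimately show ?thesis
    by (simp add: cnorm_direct_sum_map_power2)
qed

lemma proper_holomorphic_ball_map_direct_sum_map:
  assumes p: "polynomial_map k p" and h: "polynomial_map m h" and g: "polynomial_map l g"
    and sphere: "\<And>z. norm z = 1 \<Longrightarrow> (cnorm k (p z))\<^sup>2 + (cnorm m (h z))\<^sup>2 = 1"
    and p_less_1: "\<And>z. norm z = 1 \<Longrightarrow> cnorm k (p z) < 1"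
    and norm_g: "\<And>z. (cnorm l (g z))\<^sup>2 = (norm z)\<^sup>2 * (cnorm m (h z))\<^sup>2"
  shows "proper_holomorphic_ball_map (k + l) (direct_sum_map k p g)"
proof (rule proper_holomorphic_ball_map_polynomial_map[OF polynomial_map_direct_sum_map[OF p g]])
  have norm_f: "(cnorm (k + l) (direct_sum_map k p g z))\<^sup>2 =
      (cnorm k (p z))\<^sup>2 + (norm z)\<^sup>2 * (cnorm m (h z))\<^sup>2" for z
    by (simp add: cnorm_direct_sum_map_power2 norm_g)
  show "cnorm (k + l) (direct_sum_map k p g z) < 1" if "norm z < 1" for z
    using direct_sum_tensor_norm_less_1[OF p h sphere p_less_1 that]
    by (simp add: abs_square_less_1 flip: norm_f)
  show "cnorm (k + l) (direct_sum_map k p g z) = 1" if "norm z = 1" for z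
    using norm_f[of z] sphere[OF that] that cnorm_nonneg[of "k + l" "direct_sum_map k p g z"]
    by (auto simp: power2_eq_1_iff)
qed

theorem theorem2:
  fixes p :: "complex^'n \<Rightarrow> nat \<Rightarrow> complex" and k :: nat
  assumes "k \<ge> 1"
    and "polynomial_map k p"
    and "\<forall>z\<in>sphere 0 1. (cnorm k (p z))\<^sup>2 < 1"
  shows "\<exists>N g. N > k \<and> polynomial_map (N - k) g \<and>
           proper_holomorphic_ball_map N (direct_sum_map k p g)"
proof -
  have p_less_1: "cnorm k (p z) < 1" if "norm z = 1" for z
    using assms(3) that by (simp add: abs_square_less_1)
  have "squared_norm_on (sphere 0 1) (\<lambda>z. 1 - (cnorm k (p z))\<^sup>2)"
    using assms(3) real_polynomial_function_cnorm_power2[OF assms(2)]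
    by (intro pos_on_sphere_imp_squared_norm_on) auto
  then obtain m h where h: "polynomial_map m h"
    and sphere: "\<And>z. norm z = 1 \<Longrightarrow> (cnorm k (p z))\<^sup>2 + (cnorm m (h z))\<^sup>2 = 1"
    unfolding squared_norm_on_def by force
  have "squared_norm_on UNIV (\<lambda>z. (norm z)\<^sup>2 * (cnorm m (h z))\<^sup>2)"
    using squared_norm_on_mult[OF squared_norm_on_norm_add_power2[of _ 0]
        squared_norm_on_cnorm_power2[OF h]] by simp
  then obtain l g where g: "polynomial_map l g"
    and norm_g: "\<And>z. (cnorm l (g z))\<^sup>2 = (norm z)\<^sup>2 * (cnorm m (h z))\<^sup>2"
    unfolding squared_norm_on_def by (metis UNIV_I)
  obtain w :: "complex^'n" where "norm w = 1"
    using vector_choose_size[of 1] by auto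
  then have "(cnorm l (g w))\<^sup>2 > 0"
    using norm_g[of w] sphere[of w] assms(3) by force
  then have "l \<noteq> 0"
    by (intro notI) (simp add: cnorm_def)
  with g show ?thesis
    using proper_holomorphic_ball_map_direct_sum_map[OF assms(2) h g sphere p_less_1 norm_g]
    by (intro exI[of _ "k + l"] exI[of _ g]) simp
qed

end
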